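(* Let $n\ge 3$ and $b\ge 2$ be integers and let $D(T_n^{(b)})$ be the distance matrix of the graph $T_n^{(b)}$. Then $$\det D(T_n^{(b)}) = (-1)^{b(n-4)+1}\, 2^{b(n-3)+1}\, b\, (n-6)^{b-1}.$$
   Context: For $n\ge 3$, $T_n$ is the simple graph on $n$ vertices consisting of $n-2$ triangles with a common base: it has two adjacent base vertices, and $n-2$ non-base vertices, each adjacent to exactly the two base vertices and to no other vertex. (For $n=3$, $T_3=K_3$, with two vertices designated as base vertices.) For $n\ge 3$ and $b\ge 2$, $T_n^{(b)}$ is the graph obtained from $b$ copies of $T_n$ (its blocks) by identifying one non-base vertex from each copy into a single vertex, the central cut vertex; thus it has $b(n-1)+1$ vertices. The distance matrix $D(G)=[d_{ij}]$ of a connected graph $G$ has $d_{ij}$ equal to the length of a shortest path from $i$ to $j$ for $i\ne j$, and $d_{ii}=0$. *)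

theory Defs
  imports
    "Jordan_Normal_Form.Determinant"
    "Graph_Theory.Pair_Digraph"
    "Graph_Theory.Shortest_Path"
begin

text \<open>Simple graphs are represented as loop-free digraphs without parallel arcs whose arc
  relation is symmetric.\<close>

text \<open>The graph of \<open>n - 2\<close> triangles on a common base, on the vertices \<open>0, \<dots>, n - 1\<close>:
  the base vertices are \<open>0\<close> and \<open>1\<close>.\<close>

definition triangles_common_base :: "nat \<Rightarrow> nat pair_pre_digraph" where
  "triangles_common_base n =
     \<lparr> pverts = {..<n},
       parcs = {(u, v). u < n \<and> v < n \<and> u \<noteq> v \<and> (u \<in> {0, 1} \<or> v \<in> {0, 1})} \<rparr>"

text \<open>Vertex \<open>v\<close> of the \<open>k\<close>-th copy of a graph is \<open>Some (k, v)\<close>, except that the vertex \<open>c\<close>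
  of every copy becomes the single vertex \<open>None\<close>.\<close>

definition copy_vertex :: "'a \<Rightarrow> nat \<Rightarrow> 'a \<Rightarrow> (nat \<times> 'a) option" where
  "copy_vertex c k v = (if v = c then None else Some (k, v))"

definition glue_copies ::
    "nat \<Rightarrow> 'a \<Rightarrow> 'a pair_pre_digraph \<Rightarrow> (nat \<times> 'a) option pair_pre_digraph" where
  "glue_copies b c G =
     \<lparr> pverts = (\<Union>k<b. copy_vertex c k ` pverts G),
       parcs = (\<Union>k<b. map_prod (copy_vertex c k) (copy_vertex c k) ` parcs G) \<rparr>"

text \<open>The copies are glued at vertex \<open>2\<close>, which is a non-base vertex for \<open>n \<ge> 3\<close>. Any other
  non-base vertex gives an isomorphic graph, as the non-base vertices are interchangeable.\<close>

definition triangles_block_graph :: "nat \<Rightarrow> nat \<Rightarrow> (nat \<times> nat) option pair_pre_digraph" where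
  "triangles_block_graph n b = glue_copies b 2 (triangles_common_base n)"

text \<open>The length of a shortest path is the library's shortest-path cost \<open>\<mu>\<close> for unit weights.
  It is finite, so that \<open>real_of_ereal\<close> is harmless, whenever the graph is connected.\<close>

definition graph_dist :: "'a pair_pre_digraph \<Rightarrow> 'a \<Rightarrow> 'a \<Rightarrow> real" where
  "graph_dist G u v = real_of_ereal (wf_digraph.\<mu> (with_proj G) (\<lambda>_. 1) u v)"

text \<open>The list \<open>vs\<close> enumerates the vertices and fixes the order of rows and columns.\<close>

definition distance_matrix :: "'a pair_pre_digraph \<Rightarrow> 'a list \<Rightarrow> real mat" where
  "distance_matrix G vs =
     mat (length vs) (length vs)
       (\<lambda>(i, j). if i = j then 0 else graph_dist G (vs ! i) (vs ! j))"

end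

theory Submission
  imports Defs
begin

text \<open>The central cut vertex lies on every path between different blocks, so the distance matrix
  is determined by its restrictions to the blocks. Write \<open>c\<close> for the basis vector of the central
  vertex and \<open>e\<^sub>0, e\<^sub>1, e\<^sub>3, \<dots>, e\<^bsub>n-1\<^esub>\<close> for those of a block, and regard the distance matrix as a
  symmetric bilinear form. In each block pass to the basis
  \<open>e\<^sub>1 - c\<close> (the centre), \<open>e\<^sub>0 - e\<^sub>1\<close> and \<open>e\<^sub>i - e\<^sub>0 - e\<^sub>1 + c\<close> for \<open>i \<ge> 3\<close> (the leaves).
  This change of basis is unitriangular, so it preserves the determinant, and the form becomes very
  sparse: vectors of different blocks are orthogonal; within a block the Gram matrix is the
  adjacency matrix of a star with \<open>n - 2\<close> leaves minus twice the identity; and \<open>c\<close> is isotropic and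
  pairs to \<open>1\<close> with every centre and to \<open>0\<close> with every leaf (\<open>block_dist_eq_star_gram\<close>).

  Adding half of every leaf to the centre of its block makes the centre orthogonal to the leaves and
  gives it the norm \<open>s = - 2 + (n - 2) / 2 = (n - 6) / 2\<close>. Every leaf contributes a factor \<open>- 2\<close>,
  and what is left is the bordered matrix with a zero corner, a border of ones, and \<open>s\<close> on the
  remaining \<open>b\<close> diagonal places, whose determinant is \<open>- b * s ^ (b - 1)\<close>: the sum of the last
  \<open>b\<close> columns minus \<open>s\<close> times the border column is \<open>b\<close> times a unit vector
  (\<open>star_gram_mult_star_elim\<close>). No step divides by \<open>s\<close>, which vanishes for
  \<open>n = 6\<close>.

  The distances come from \<open>graph_dist_eqI\<close>, which certifies a distance function by a Lipschitz
  condition along arcs together with a descent condition.\<close>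

section \<open>Determinants of matrices indexed by the entries of a list\<close>

text \<open>Rows and columns are addressed by the entries of \<open>vs\<close> instead of their positions. The
  elimination below can then be written in terms of the vertices, whatever their enumeration.\<close>

definition matrix_on :: "'v list \<Rightarrow> ('v \<Rightarrow> 'v \<Rightarrow> 'a) \<Rightarrow> 'a mat" where
  "matrix_on vs F = mat (length vs) (length vs) (\<lambda>(i, j). F (vs ! i) (vs ! j))"

lemma matrix_on_carrier [simp]: "matrix_on vs F \<in> carrier_mat (length vs) (length vs)"
  by (simp add: matrix_on_def)

lemma sum_set_eq_sum_nth:
  assumes "distinct vs"
  shows "(\<Sum>w\<in>set vs. g w) = (\<Sum>i<length vs. g (vs ! i))"
  using sum.reindex_bij_betw[OF bij_betw_nth[OF assms refl refl], of g] by simp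

lemma prod_set_eq_prod_nth:
  assumes "distinct vs"
  shows "(\<Prod>w\<in>set vs. g w) = (\<Prod>i<length vs. g (vs ! i))"
  using prod.reindex_bij_betw[OF bij_betw_nth[OF assms refl refl], of g] by simp

lemma matrix_on_cong:
  assumes "\<And>u v. u \<in> set vs \<Longrightarrow> v \<in> set vs \<Longrightarrow> F u v = G u v"
  shows "matrix_on vs F = matrix_on vs G"
  using assms by (auto simp: matrix_on_def)

lemma matrix_on_mult:
  fixes F G :: "'v \<Rightarrow> 'v \<Rightarrow> 'a :: comm_ring_1"
  assumes "distinct vs"
  shows "matrix_on vs F * matrix_on vs G = matrix_on vs (\<lambda>u v. \<Sum>w\<in>set vs. F u w * G w v)"
  using assms
  by (intro eq_matI)
     (auto simp: matrix_on_def scalar_prod_def sum_set_eq_sum_nth atLeast0LessThan)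

lemma det_matrix_on_mult:
  fixes F G :: "'v \<Rightarrow> 'v \<Rightarrow> 'a :: comm_ring_1"
  assumes "distinct vs"
  shows "det (matrix_on vs (\<lambda>u v. \<Sum>w\<in>set vs. F u w * G w v))
    = det (matrix_on vs F) * det (matrix_on vs G)"
  unfolding matrix_on_mult[OF assms, symmetric]
  by (rule det_mult[OF matrix_on_carrier matrix_on_carrier])

lemma det_matrix_on_transpose:
  "det (matrix_on vs (\<lambda>u v. F v u)) = det (matrix_on vs (F :: 'v \<Rightarrow> 'v \<Rightarrow> 'a :: comm_ring_1))"
proof -
  have "matrix_on vs (\<lambda>u v. F v u) = transpose_mat (matrix_on vs F)"
    by (intro eq_matI) (auto simp: matrix_on_def)
  then show ?thesis
    by (simp add: det_transpose[OF matrix_on_carrier])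
qed

text \<open>Triangularity is expressed by a rank function, since the order of \<open>vs\<close> need not be compatible
  with it. In the Leibniz formula, a permutation with a non-vanishing product lowers the rank at every
  point that it moves; since it preserves the sum of all ranks, it moves none.\<close>
lemma det_matrix_on_triangular:
  fixes F :: "'v \<Rightarrow> 'v \<Rightarrow> 'a :: comm_ring_1" and rank :: "'v \<Rightarrow> nat"
  assumes "distinct vs"
    and triangular: "\<And>u v. u \<in> set vs \<Longrightarrow> v \<in> set vs \<Longrightarrow> u \<noteq> v \<Longrightarrow> rank u \<le> rank v \<Longrightarrow> F u v = 0"
  shows "det (matrix_on vs F) = (\<Prod>v\<in>set vs. F v v)"
proof -
  let ?n = "length vs"
  let ?A = "matrix_on vs F"
  let ?t = "\<lambda>p. signof p * (\<Prod>i = 0..<?n. ?A $$ (i, p i))"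
  have zero: "?t p = 0" if p: "p permutes {0..<?n}" and "p \<noteq> id" for p
  proof -
    have lt: "p i < ?n" if "i < ?n" for i
      using permutes_in_image[OF p, of i] that by simp
    have "\<exists>i<?n. p i \<noteq> i \<and> rank (vs ! i) \<le> rank (vs ! p i)"
    proof (rule ccontr)
      assume "\<not> ?thesis"
      then have desc: "rank (vs ! p i) < rank (vs ! i)" if "i < ?n" "p i \<noteq> i" for i
        using that by (meson not_le)
      obtain j where j: "p j \<noteq> j"
        using \<open>p \<noteq> id\<close> by (auto simp: fun_eq_iff)
      with p have "j < ?n"
        by (meson atLeastLessThan_iff permutes_not_in zero_le)
      then have "(\<Sum>i\<in>{0..<?n}. rank (vs ! p i)) < (\<Sum>i\<in>{0..<?n}. rank (vs ! i))"
        using desc j by (intro sum_strict_mono_ex1) (force intro: less_imp_le)+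
      moreover have "(\<Sum>i\<in>{0..<?n}. rank (vs ! p i)) = (\<Sum>i\<in>{0..<?n}. rank (vs ! i))"
        using sum.permute[OF p, of "\<lambda>i. rank (vs ! i)"] by (simp add: comp_def)
      ultimately show False by simp
    qed
    then obtain i where i: "i < ?n" "p i \<noteq> i" "rank (vs ! i) \<le> rank (vs ! p i)"
      by blast
    then have "vs ! i \<noteq> vs ! p i"
      using lt[OF i(1)] assms(1) by (metis nth_eq_iff_index_eq)
    then have "?A $$ (i, p i) = 0"
      using i lt[OF i(1)] by (simp add: matrix_on_def triangular)
    then have "(\<Prod>i = 0..<?n. ?A $$ (i, p i)) = 0"
      using i(1) by (intro prod_zero) auto
    then show ?thesis by simp
  qed
  have "det ?A = (\<Sum>p | p permutes {0..<?n}. ?t p)"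
    by (rule det_def'[OF matrix_on_carrier])
  also have "\<dots> = (\<Sum>p\<in>{id}. ?t p)"
    using zero by (intro sum.mono_neutral_right) (auto simp: finite_permutations permutes_id)
  also have "\<dots> = (\<Prod>v\<in>set vs. F v v)"
    by (simp add: prod_set_eq_prod_nth[OF assms(1)] matrix_on_def atLeast0LessThan)
  finally show ?thesis .
qed

lemma det_matrix_on_swap:
  fixes F :: "'v \<Rightarrow> 'v \<Rightarrow> 'a :: comm_ring_1"
  assumes "distinct vs" "a \<in> set vs" "b \<in> set vs" "a \<noteq> b"
  shows "det (matrix_on vs (\<lambda>u. F (Transposition.transpose a b u))) = - det (matrix_on vs F)"
proof -
  obtain i j where ij: "i < length vs" "j < length vs" "a = vs ! i" "b = vs ! j"
    using assms(2,3) by (metis in_set_conv_nth)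
  let ?p = "Transposition.transpose i j"
  have p: "?p permutes {0..<length vs}"
    using ij by (intro permutes_swap_id) auto
  have lt: "?p k < length vs" if "k < length vs" for k
    using ij that by (auto simp: Transposition.transpose_def)
  have nth: "vs ! ?p k = Transposition.transpose a b (vs ! k)" if "k < length vs" for k
    using ij that assms(1) by (auto simp: Transposition.transpose_def nth_eq_iff_index_eq)
  have "matrix_on vs (\<lambda>u. F (Transposition.transpose a b u))
      = mat (length vs) (length vs) (\<lambda>(k, l). matrix_on vs F $$ (?p k, l))"
    by (intro eq_matI) (auto simp: matrix_on_def nth lt)
  moreover have "i \<noteq> j" using ij assms(4) by auto
  ultimately show ?thesis
    using det_permute_rows[OF matrix_on_carrier p, of F]
    by (simp add: sign_swap_id)
qed

section \<open>Distances in the block graph\<close>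

text \<open>By \<open>step\<close>, a walk from \<open>x\<close> to \<open>v\<close> has at least \<open>d x\<close> arcs; by \<open>descent\<close>, following arcs along
  which \<open>d\<close> drops yields a walk with exactly \<open>d x\<close> arcs.\<close>
lemma graph_dist_eqI:
  fixes d :: "'a \<Rightarrow> nat"
  assumes "pair_wf_digraph G" and "u \<in> pverts G"
    and zero: "d v = 0"
    and step: "\<And>x y. (x, y) \<in> parcs G \<Longrightarrow> d x \<le> Suc (d y)"
    and descent: "\<And>x. x \<in> pverts G \<Longrightarrow> x \<noteq> v \<Longrightarrow> \<exists>y. (x, y) \<in> parcs G \<and> d x = Suc (d y)"
  shows "graph_dist G u v = real (d u)"
proof -
  interpret pair_wf_digraph G by fact
  let ?c = "\<lambda>_ :: 'a \<times> 'a. 1 :: real"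
  have cost: "awalk_cost ?c p = real (length p)" for p
    by (induction p) auto
  have lower: "d x \<le> length p" if "awalk x p v" for x p
    using that
  proof (induction p arbitrary: x)
    case Nil
    then show ?case by (auto simp: awalk_Nil_iff zero)
  next
    case (Cons e p)
    then have "(x, snd e) \<in> parcs G" "d (snd e) \<le> length p"
      by (auto simp: awalk_Cons_iff)
    then show ?case using step[of x "snd e"] by simp
  qed
  have upper: "\<exists>p. awalk x p v \<and> length p = d x" if "x \<in> pverts G" for x
    using that
  proof (induction "d x" arbitrary: x)
    case 0
    then have "x = v" using descent[of x] by force
    then show ?case using 0 by (intro exI[of _ "[]"]) (simp add: awalk_Nil_iff)
  next
    case (Suc m)
    then have "x \<noteq> v" using zero by auto
    then obtain y where y: "(x, y) \<in> parcs G" "d x = Suc (d y)"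
      using descent Suc.prems by blast
    moreover have "y \<in> pverts G" using y(1) by (rule in_arcsD2)
    ultimately obtain p where "awalk y p v" "length p = d y"
      using Suc by fastforce
    with y show ?case
      by (intro exI[of _ "(x, y) # p"]) (simp add: awalk_Cons_iff Suc.prems)
  qed
  have "\<mu> ?c u v = ereal (real (d u))"
    unfolding \<mu>_def
  proof (rule INF_eqI)
    fix p assume "p \<in> {p. awalk u p v}"
    then show "ereal (real (d u)) \<le> ereal (awalk_cost ?c p)"
      using lower by (simp add: cost)
  next
    fix z assume *: "\<And>p. p \<in> {p. awalk u p v} \<Longrightarrow> z \<le> ereal (awalk_cost ?c p)"
    obtain p where "awalk u p v" "length p = d u"
      using upper assms(2) by blast
    with * show "z \<le> ereal (real (d u))"
      by (metis cost mem_Collect_eq)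
  qed
  then show ?thesis by (simp add: graph_dist_def)
qed

lemma pverts_triangles_block_graph:
  assumes "n \<ge> 3" "b \<ge> 1"
  shows "pverts (triangles_block_graph n b) = insert None (Some ` ({..<b} \<times> ({..<n} - {2})))"
proof (rule Set.set_eqI)
  fix v :: "(nat \<times> nat) option"
  show "v \<in> pverts (triangles_block_graph n b) \<longleftrightarrow> v \<in> insert None (Some ` ({..<b} \<times> ({..<n} - {2})))"
  proof (cases v)
    case None
    have "0 < b" "2 < n" using assms by auto
    then have "\<exists>k<b. \<exists>i<n. i = 2" by blast
    then show ?thesis using None
      by (auto simp: triangles_block_graph_def glue_copies_def triangles_common_base_def
          copy_vertex_def image_iff)
  next
    case (Some p)
    then show ?thesis
      by (cases p) (auto simp: triangles_block_graph_def glue_copies_def triangles_common_base_def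
          copy_vertex_def image_iff)
  qed
qed

lemma parcs_triangles_block_graph:
  assumes "n \<ge> 3"
  shows "(None, None) \<notin> parcs (triangles_block_graph n b)"
    and "(None, Some (k, i)) \<in> parcs (triangles_block_graph n b) \<longleftrightarrow> k < b \<and> i < 2"
    and "(Some (k, i), None) \<in> parcs (triangles_block_graph n b) \<longleftrightarrow> k < b \<and> i < 2"
    and "(Some (k, i), Some (l, j)) \<in> parcs (triangles_block_graph n b) \<longleftrightarrow>
      k = l \<and> k < b \<and> i < n \<and> j < n \<and> i \<noteq> 2 \<and> j \<noteq> 2 \<and> i \<noteq> j \<and> (i < 2 \<or> j < 2)"
proof -
  have arc: "e \<in> parcs (triangles_block_graph n b) \<longleftrightarrow> (\<exists>k u v. k < b \<and> u < n \<and> v < n \<and> u \<noteq> v \<and> (u < 2 \<or> v < 2) \<and>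
      e = (copy_vertex 2 k u, copy_vertex 2 k v))" for e
    by (cases e) (auto simp: triangles_block_graph_def glue_copies_def triangles_common_base_def
          less_2_cases_iff map_prod_def image_iff split: prod.splits)
  have copy: "None = copy_vertex 2 l u \<longleftrightarrow> u = 2"
      "Some (k, i) = copy_vertex 2 l u \<longleftrightarrow> k = l \<and> i = u \<and> i \<noteq> 2" for l u k i :: nat
    by (auto simp: copy_vertex_def)
  show "(None, None) \<notin> parcs (triangles_block_graph n b)"
    unfolding arc by (auto simp: copy)
  show "(None, Some (k, i)) \<in> parcs (triangles_block_graph n b) \<longleftrightarrow> k < b \<and> i < 2"
    unfolding arc using assms by (auto simp: copy)
  show "(Some (k, i), None) \<in> parcs (triangles_block_graph n b) \<longleftrightarrow> k < b \<and> i < 2"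
    unfolding arc using assms by (auto simp: copy)
  show "(Some (k, i), Some (l, j)) \<in> parcs (triangles_block_graph n b) \<longleftrightarrow>
      k = l \<and> k < b \<and> i < n \<and> j < n \<and> i \<noteq> 2 \<and> j \<noteq> 2 \<and> i \<noteq> j \<and> (i < 2 \<or> j < 2)"
    unfolding arc by (auto simp: copy)
qed

lemma pair_wf_triangles_block_graph: "pair_wf_digraph (triangles_block_graph n b)"
proof -
  have "fst e \<in> pverts (triangles_block_graph n b) \<and> snd e \<in> pverts (triangles_block_graph n b)"
    if e: "e \<in> parcs (triangles_block_graph n b)" for e
  proof -
    obtain k u v where "k < b" "u < n" "v < n" "e = (copy_vertex 2 k u, copy_vertex 2 k v)"
      using e by (auto simp: triangles_block_graph_def glue_copies_def triangles_common_base_def)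
    then show ?thesis
      by (auto simp: triangles_block_graph_def glue_copies_def triangles_common_base_def)
  qed
  then show ?thesis by unfold_locales auto
qed

text \<open>The last line is the distance through the central vertex, which is at distance \<open>1\<close> from
  the base vertices \<open>0\<close> and \<open>1\<close> of each block and at distance \<open>2\<close> from its other vertices.\<close>
fun block_dist :: "(nat \<times> nat) option \<Rightarrow> (nat \<times> nat) option \<Rightarrow> nat" where
  "block_dist None None = 0"
| "block_dist None (Some (k, i)) = (if i < 2 then 1 else 2)"
| "block_dist (Some (k, i)) None = (if i < 2 then 1 else 2)"
| "block_dist (Some (k, i)) (Some (l, j)) =
    (if k = l then if i = j then 0 else if i < 2 \<or> j < 2 then 1 else 2
     else (if i < 2 then 1 else 2) + (if j < 2 then 1 else 2))"

lemma graph_dist_triangles_block_graph: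
  assumes "n \<ge> 3" "b \<ge> 1"
    and u: "u \<in> pverts (triangles_block_graph n b)" and v: "v \<in> pverts (triangles_block_graph n b)"
  shows "graph_dist (triangles_block_graph n b) u v = real (block_dist u v)"
proof (rule graph_dist_eqI[where d = "\<lambda>x. block_dist x v", OF pair_wf_triangles_block_graph u])
  note arcs = parcs_triangles_block_graph[OF assms(1)]
  note verts = pverts_triangles_block_graph[OF assms(1,2)]
  show "block_dist v v = 0"
    by (cases v) auto
  show "block_dist x v \<le> Suc (block_dist y v)" if "(x, y) \<in> parcs (triangles_block_graph n b)" for x y
    using that by (cases x; cases y; cases v) (auto simp: arcs split: if_splits)
  \<comment> \<open>Towards a vertex that is not adjacent, a base vertex moves to the central vertex, and every
    other vertex to the base vertex \<open>0\<close> of a block: of its own block, or of the block of \<open>v\<close> if it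
    is the central vertex.\<close>
  show "\<exists>y. (x, y) \<in> parcs (triangles_block_graph n b) \<and> block_dist x v = Suc (block_dist y v)"
    if x: "x \<in> pverts (triangles_block_graph n b)" and "x \<noteq> v" for x
  proof (cases x)
    case None
    then obtain l j where v': "v = Some (l, j)" "l < b" using \<open>x \<noteq> v\<close> v verts by auto
    show ?thesis
    proof (cases "j < 2")
      case True
      then show ?thesis using None v' by (intro exI[of _ v]) (auto simp: arcs)
    next
      case False
      then show ?thesis using None v' by (intro exI[of _ "Some (l, 0)"]) (auto simp: arcs)
    qed
  next
    case (Some p)
    then obtain k i where x': "x = Some (k, i)" "k < b" "i < n" "i \<noteq> 2"
      using x verts by auto
    show ?thesis
    proof (cases "\<exists>j. v = Some (k, j)")
      case True
      then obtain j where v': "v = Some (k, j)" "j < n" "j \<noteq> 2" "i \<noteq> j"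
        using v verts \<open>x \<noteq> v\<close> x' by auto
      show ?thesis
      proof (cases "i < 2 \<or> j < 2")
        case True
        then show ?thesis using x' v' by (intro exI[of _ v]) (auto simp: arcs)
      next
        case False
        then show ?thesis using x' v' assms(1)
          by (intro exI[of _ "Some (k, 0)"]) (auto simp: arcs)
      qed
    next
      case other: False
      show ?thesis
      proof (cases "i < 2")
        case True
        then show ?thesis using x' other
          by (intro exI[of _ None], cases v) (auto simp: arcs)
      next
        case False
        then show ?thesis using x' other assms(1)
          by (intro exI[of _ "Some (k, 0)"], cases v) (auto simp: arcs)
      qed
    qed
  qed
qed

section \<open>A basis with a sparse Gram matrix\<close>

text \<open>The value at the basis vector of the vertex \<open>u\<close> of the linear functional that takes the values
  \<open>g\<close> on the new basis, whose vectors are again labelled by vertices: \<open>None\<close> for \<open>c\<close>,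
  \<open>Some (k, 1)\<close> for \<open>e\<^sub>1 - c\<close>, \<open>Some (k, 0)\<close> for \<open>e\<^sub>0 - e\<^sub>1\<close>, and \<open>Some (k, i)\<close> with \<open>i \<ge> 3\<close> for
  \<open>e\<^sub>i - e\<^sub>0 - e\<^sub>1 + c\<close>. A functional in place of a coordinate vector lets the simplifier evaluate
  sums against the sparse coordinates.\<close>
definition in_gram_basis :: "(nat \<times> nat) option \<Rightarrow> ((nat \<times> nat) option \<Rightarrow> real) \<Rightarrow> real" where
  "in_gram_basis u g = (case u of
      None \<Rightarrow> g None
    | Some (k, i) \<Rightarrow>
        if i = 1 then g (Some (k, 1)) + g None
        else if i = 0 then g (Some (k, 0)) + g (Some (k, 1)) + g None
        else g (Some (k, i)) + g (Some (k, 0)) + 2 * g (Some (k, 1)) + g None)"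

lemma in_gram_basis_simps:
  "in_gram_basis None g = g None"
  "in_gram_basis (Some (k, 0)) g = g (Some (k, 0)) + g (Some (k, Suc 0)) + g None"
  "in_gram_basis (Some (k, Suc 0)) g = g (Some (k, Suc 0)) + g None"
  "2 < i \<Longrightarrow> in_gram_basis (Some (k, i)) g =
    g (Some (k, i)) + g (Some (k, 0)) + 2 * g (Some (k, Suc 0)) + g None"
  by (auto simp: in_gram_basis_def)

text \<open>The restriction to the vectors of one block is minus the Cartan matrix of a star with \<open>n - 2\<close> leaves, which is
  singular precisely for four leaves, that is for \<open>n = 6\<close>.\<close>
fun star_gram :: "(nat \<times> nat) option \<Rightarrow> (nat \<times> nat) option \<Rightarrow> real" where
  "star_gram None None = 0"
| "star_gram None (Some (k, i)) = (if i = 1 then 1 else 0)"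
| "star_gram (Some (k, i)) None = (if i = 1 then 1 else 0)"
| "star_gram (Some (k, i)) (Some (l, j)) =
    (if k \<noteq> l then 0 else if i = j then - 2 else if i = 1 \<or> j = 1 then 1 else 0)"

text \<open>This says \<open>D = L * N * L\<^sup>T\<close> for the distance matrix \<open>D\<close>, the Gram matrix \<open>N\<close> and the
  matrix \<open>L\<close> of coordinates in the new basis. The excluded label \<open>2\<close> is the one that the gluing
  replaces by \<open>None\<close>.\<close>
lemma block_dist_eq_star_gram:
  assumes "u \<in> insert None (Some ` (UNIV \<times> - {2}))" "v \<in> insert None (Some ` (UNIV \<times> - {2}))"
  shows "real (block_dist u v) = in_gram_basis u (\<lambda>a. in_gram_basis v (\<lambda>c. star_gram a c))"
proof -
  have cases: "u = None \<or> (\<exists>k. u = Some (k, 0)) \<or> (\<exists>k. u = Some (k, Suc 0)) \<or> (\<exists>k i. 2 < i \<and> u = Some (k, i))"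
    if "u \<in> insert None (Some ` (UNIV \<times> - {2}))" for u :: "(nat \<times> nat) option"
    using that by (auto simp: nat_neq_iff less_2_cases_iff)
  show ?thesis
    using cases[OF assms(1)] cases[OF assms(2)]
    by (elim disjE exE conjE; simp add: in_gram_basis_simps)
qed

lemma sum_block_vertices:
  fixes h :: "(nat \<times> nat) option \<Rightarrow> 'a :: comm_monoid_add"
  assumes "n \<ge> 3"
  shows "sum h (insert None (Some ` ({..<b} \<times> ({..<n} - {2}))))
    = h None + (\<Sum>k<b. h (Some (k, 1)) + (\<Sum>i\<in>{..<n} - {1, 2}. h (Some (k, i))))"
proof -
  have "sum g ({..<n} - {2}) = g 1 + sum g ({..<n} - {1, 2})" for g :: "nat \<Rightarrow> 'a"
  proof -
    have "{..<n} - {2} = insert 1 ({..<n} - {1, 2})"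
      using assms by auto
    moreover have "sum g (insert 1 ({..<n} - {1, 2})) = g 1 + sum g ({..<n} - {1, 2})"
      by (rule sum.insert) auto
    ultimately show ?thesis by (simp only:)
  qed
  moreover have "(\<Sum>p\<in>{..<b} \<times> ({..<n} - {2}). h (Some p)) = (\<Sum>k<b. \<Sum>i\<in>{..<n} - {2}. h (Some (k, i)))"
    by (simp add: sum.cartesian_product case_prod_unfold)
  ultimately show ?thesis
    by (simp add: sum.reindex)
qed

lemma prod_block_vertices:
  fixes h :: "(nat \<times> nat) option \<Rightarrow> 'a :: comm_monoid_mult"
  assumes "n \<ge> 3"
  shows "prod h (insert None (Some ` ({..<b} \<times> ({..<n} - {2}))))
    = h None * (\<Prod>k<b. h (Some (k, 1)) * (\<Prod>i\<in>{..<n} - {1, 2}. h (Some (k, i))))"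
proof -
  have "prod g ({..<n} - {2}) = g 1 * prod g ({..<n} - {1, 2})" for g :: "nat \<Rightarrow> 'a"
  proof -
    have "{..<n} - {2} = insert 1 ({..<n} - {1, 2})"
      using assms by auto
    moreover have "prod g (insert 1 ({..<n} - {1, 2})) = g 1 * prod g ({..<n} - {1, 2})"
      by (rule prod.insert) auto
    ultimately show ?thesis by (simp only:)
  qed
  moreover have "(\<Prod>p\<in>{..<b} \<times> ({..<n} - {2}). h (Some p)) = (\<Prod>k<b. \<Prod>i\<in>{..<n} - {2}. h (Some (k, i)))"
    by (simp add: prod.cartesian_product case_prod_unfold)
  ultimately show ?thesis
    by (simp add: prod.reindex)
qed

lemma sum_in_gram_basis:
  assumes "n \<ge> 3" and V: "V = insert None (Some ` ({..<b} \<times> ({..<n} - {2})))" and "u \<in> V"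
  shows "(\<Sum>a\<in>V. in_gram_basis u (\<lambda>t. if t = a then 1 else 0) * g a) = in_gram_basis u g"
proof -
  have "finite V" by (simp add: V)
  then have single: "(\<Sum>a\<in>V. (if t = a then 1 else 0) * g a) = (if t \<in> V then g t else 0)" for t
    by (simp add: if_distrib[of "\<lambda>x. x * _"] cong: if_cong)
  have centre: "None \<in> V" by (simp add: V)
  have base: "Some (k, 0) \<in> V" "Some (k, 1) \<in> V" if "Some (k, i) \<in> V" for k i
    using that assms(1) by (auto simp: V)
  show ?thesis
    using \<open>u \<in> V\<close> centre base
    by (auto simp: in_gram_basis_def distrib_right sum.distrib mult.assoc sum_distrib_left[symmetric] single
        split: option.splits)
qed

text \<open>In the order central vertex, \<open>1\<close>, \<open>0\<close>, other vertices, each old basis vector is the new one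
  with the same label plus a combination of earlier ones.\<close>
lemma det_in_gram_basis:
  assumes "distinct vs"
  shows "det (matrix_on vs (\<lambda>u a. in_gram_basis u (\<lambda>t. if t = a then 1 else 0))) = 1"
proof -
  define rank where "rank = (\<lambda>v :: (nat \<times> nat) option. case v of
    None \<Rightarrow> 0 | Some (k, i) \<Rightarrow> if i = 1 then 1 else if i = 0 then 2 else (3 :: nat))"
  have "det (matrix_on vs (\<lambda>u a. in_gram_basis u (\<lambda>t. if t = a then 1 else 0)))
    = (\<Prod>v\<in>set vs. in_gram_basis v (\<lambda>t. if t = v then 1 else 0))"
    by (rule det_matrix_on_triangular[OF assms, where rank = rank])
       (auto simp: in_gram_basis_def rank_def split: option.splits if_splits)
  also have "\<dots> = 1"
    by (rule prod.neutral) (auto simp: in_gram_basis_def split: option.splits)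
  finally show ?thesis .
qed

lemma det_block_dist_eq_det_star_gram:
  assumes "n \<ge> 3" "distinct vs" and V: "set vs = insert None (Some ` ({..<b} \<times> ({..<n} - {2})))"
  shows "det (matrix_on vs (\<lambda>u v. real (block_dist u v))) = det (matrix_on vs star_gram)"
proof -
  let ?L = "\<lambda>u a. in_gram_basis u (\<lambda>t. if t = a then 1 else 0)"
  let ?N = "\<lambda>a v. \<Sum>c\<in>set vs. star_gram a c * ?L v c"
  have "matrix_on vs (\<lambda>u v. real (block_dist u v)) = matrix_on vs (\<lambda>u v. \<Sum>a\<in>set vs. ?L u a * ?N a v)"
  proof (rule matrix_on_cong)
    fix u v assume uv: "u \<in> set vs" "v \<in> set vs"
    have "?N a v = in_gram_basis v (\<lambda>c. star_gram a c)" for a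
      using sum_in_gram_basis[OF assms(1) V uv(2), of "star_gram a"]
      by (simp add: mult.commute)
    then have "(\<Sum>a\<in>set vs. ?L u a * ?N a v) = in_gram_basis u (\<lambda>a. in_gram_basis v (\<lambda>c. star_gram a c))"
      using sum_in_gram_basis[OF assms(1) V uv(1)] by simp
    also have "\<dots> = real (block_dist u v)"
      using uv by (intro block_dist_eq_star_gram[symmetric]) (auto simp: V)
    finally show "real (block_dist u v) = (\<Sum>a\<in>set vs. ?L u a * ?N a v)" ..
  qed
  also have "det \<dots> = det (matrix_on vs star_gram)"
    by (simp add: det_matrix_on_mult[OF assms(2)] det_in_gram_basis[OF assms(2)]
        det_matrix_on_transpose[where F = ?L])
  finally show ?thesis .
qed

section \<open>Elimination in the Gram matrix\<close>

text \<open>Column operations collected in one matrix. The coefficients \<open>1 / 2\<close> make a centre orthogonal to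
  the leaves of its block, which have norm \<open>- 2\<close> and pair to \<open>1\<close> with it. Block \<open>0\<close> is an arbitrary
  choice of the block whose centre takes up the sum over all blocks; the coefficient \<open>- s\<close> of the
  central vector then clears the entries at all centres.\<close>
definition star_elim :: "real \<Rightarrow> (nat \<times> nat) option \<Rightarrow> (nat \<times> nat) option \<Rightarrow> real" where
  "star_elim s a v = (case v of
      None \<Rightarrow> if a = None then 1 else 0
    | Some (l, j) \<Rightarrow>
       if j \<noteq> 1 then if a = v then 1 else 0
       else case a of
          Some (k, i) \<Rightarrow> if k = l \<or> l = 0 then if i = 1 then 1 else 1 / 2 else 0
        | None \<Rightarrow> if l = 0 then - s else 0)"

text \<open>In the product of \<open>star_gram\<close> and \<open>star_elim s\<close> the improved centres keep only the norm \<open>s\<close> and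
  the pairing \<open>1\<close> with the central vector. In their sum over all blocks the entries \<open>s\<close> are cancelled
  by \<open>s\<close> times the central column, and the \<open>b\<close> pairings with the central vector remain.\<close>
definition star_reduced :: "nat \<Rightarrow> real \<Rightarrow> (nat \<times> nat) option \<Rightarrow> (nat \<times> nat) option \<Rightarrow> real" where
  "star_reduced b s u v =
     (if v = Some (0, 1) then if u = None then real b else 0
      else case v of
        None \<Rightarrow> star_gram u v
      | Some (l, j) \<Rightarrow> if j = 1 then if u = None then 1 else if u = v then s else 0
          else star_gram u v)"

lemma sum_star_gram_row:
  assumes "n \<ge> 3" and u: "u \<in> insert None (Some ` ({..<b} \<times> ({..<n} - {2})))"
  shows "(\<Sum>a\<in>insert None (Some ` ({..<b} \<times> ({..<n} - {2}))). star_gram u a * g a)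
    = (case u of
        None \<Rightarrow> \<Sum>k<b. g (Some (k, 1))
      | Some (k, i) \<Rightarrow>
          if i = 1 then g None - 2 * g (Some (k, 1)) + (\<Sum>i\<in>{..<n} - {1, 2}. g (Some (k, i)))
          else g (Some (k, 1)) - 2 * g (Some (k, i)))"
proof (cases u)
  case None
  then show ?thesis by (simp add: sum_block_vertices[OF assms(1)])
next
  case (Some p)
  then obtain k i where u': "u = Some (k, i)" "k < b" "i < n" "i \<noteq> 2" using u by auto
  let ?S = "{..<n} - {1, 2}"
  have block: "(\<Sum>l<b. star_gram u (Some (l, 1)) * g (Some (l, 1)) + (\<Sum>j\<in>?S. star_gram u (Some (l, j)) * g (Some (l, j))))
     = star_gram u (Some (k, 1)) * g (Some (k, 1)) + (\<Sum>j\<in>?S. star_gram u (Some (k, j)) * g (Some (k, j)))"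
    (is "sum ?f _ = _")
  proof -
    have "sum ?f {..<b} = sum ?f {k}"
      using u' by (intro sum.mono_neutral_right) auto
    then show ?thesis by simp
  qed
  have leaves: "(\<Sum>j\<in>?S. star_gram u (Some (k, j)) * g (Some (k, j)))
      = (if i = 1 then \<Sum>j\<in>?S. g (Some (k, j)) else - 2 * g (Some (k, i)))"
  proof (cases "i = 1")
    case True
    then show ?thesis using u' by (auto intro: sum.cong)
  next
    case False
    then have "(\<Sum>j\<in>?S. star_gram u (Some (k, j)) * g (Some (k, j)))
       = (\<Sum>j\<in>?S. if i = j then - 2 * g (Some (k, j)) else 0)"
      using u' by (intro sum.cong) auto
    then show ?thesis using u' False by (simp add: sum.delta)
  qed
  show ?thesis
    unfolding sum_block_vertices[OF assms(1)] block leaves using u' by simp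
qed

lemma star_gram_mult_star_elim:
  assumes "n \<ge> 3" "b \<ge> 1" and s: "s = (real n - 6) / 2"
    and u: "u \<in> insert None (Some ` ({..<b} \<times> ({..<n} - {2})))"
    and v: "v \<in> insert None (Some ` ({..<b} \<times> ({..<n} - {2})))"
  shows "(\<Sum>a\<in>insert None (Some ` ({..<b} \<times> ({..<n} - {2}))). star_gram u a * star_elim s a v)
    = star_reduced b s u v"
proof -
  have card: "card ({..<n} - {1, 2}) = n - 2"
    using assms(1) by (subst card_Diff_subset) auto
  show ?thesis
    unfolding sum_star_gram_row[OF assms(1) u] using u v assms(1,2)
    by (auto simp: star_elim_def star_reduced_def s card of_nat_diff field_simps if_distrib[of real]
        sum.delta sum.delta' split: option.splits cong: if_cong)
qed

text \<open>Off the diagonal, only the centre of block \<open>0\<close> has a column that reaches other blocks or the central vector, and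
  the columns of the other centres reach only leaves.\<close>
lemma det_star_elim:
  assumes "distinct vs"
  shows "det (matrix_on vs (star_elim s)) = 1"
proof -
  define rank where "rank = (\<lambda>v :: (nat \<times> nat) option. case v of
    None \<Rightarrow> 3 | Some (k, i) \<Rightarrow> if i \<noteq> 1 then 3 else if k = 0 then 1 else (2 :: nat))"
  have "det (matrix_on vs (star_elim s)) = (\<Prod>v\<in>set vs. star_elim s v v)"
    by (rule det_matrix_on_triangular[OF assms, where rank = rank])
       (auto simp: star_elim_def rank_def split: option.splits if_splits)
  also have "\<dots> = 1"
    by (rule prod.neutral) (auto simp: star_elim_def split: option.splits)
  finally show ?thesis .
qed

text \<open>In the rows of the central vertex and of the centre of block \<open>0\<close>, the pivots lie in each
  other's column. Exchanging these two rows, at the cost of a sign, makes the matrix triangular with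
  diagonal entries \<open>1\<close> and \<open>b\<close> there, \<open>s\<close> at the other \<open>b - 1\<close> centres and \<open>- 2\<close> at the leaves.\<close>
lemma det_star_reduced:
  assumes "n \<ge> 3" "b \<ge> 1" "distinct vs" and V: "set vs = insert None (Some ` ({..<b} \<times> ({..<n} - {2})))"
  shows "det (matrix_on vs (star_reduced b s)) = - (real b * s ^ (b - 1) * (- 2) ^ (b * (n - 2)))"
proof -
  let ?swap = "Transposition.transpose None (Some (0, 1))"
  let ?H = "\<lambda>u. star_reduced b s (?swap u)"
  define rank where "rank = (\<lambda>v :: (nat \<times> nat) option. case v of
    None \<Rightarrow> 1 | Some (k, i) \<Rightarrow> if i \<noteq> 1 then 0 else if k = 0 then 3 else (2 :: nat))"
  have card: "card ({..<n} - {1, 2}) = n - 2"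
    using assms(1) by (subst card_Diff_subset) auto
  have "- det (matrix_on vs (star_reduced b s)) = det (matrix_on vs ?H)"
    using assms(1,2) by (intro det_matrix_on_swap[OF assms(3), symmetric]) (auto simp: V)
  also have "\<dots> = (\<Prod>v\<in>set vs. ?H v v)"
    by (rule det_matrix_on_triangular[OF assms(3), where rank = rank])
       (auto simp: star_reduced_def rank_def Transposition.transpose_def split: option.splits if_splits)
  also have "\<dots> = (\<Prod>k<b. (if k = 0 then real b else s) * (- 2) ^ (n - 2))"
  proof -
    have "?H None None = 1"
      and "?H (Some (k, 1)) (Some (k, 1)) = (if k = 0 then real b else s)"
      and "i \<noteq> 1 \<Longrightarrow> ?H (Some (k, i)) (Some (k, i)) = - 2" for k i
      by (auto simp: star_reduced_def Transposition.transpose_def)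
    then show ?thesis
      unfolding V prod_block_vertices[OF assms(1)] by (simp add: card[simplified])
  qed
  also have "\<dots> = (\<Prod>k<b. if k = 0 then real b else s) * (- 2) ^ (b * (n - 2))"
    by (simp add: prod.distrib power_mult[symmetric] mult.commute)
  also have "(\<Prod>k<b. if k = 0 then real b else s) = real b * s ^ (b - 1)"
  proof -
    obtain m where "b = Suc m" using assms(2) by (cases b) auto
    then show ?thesis by (simp only: prod.lessThan_Suc_shift) simp
  qed
  finally show ?thesis by simp
qed

lemma det_star_gram:
  assumes "n \<ge> 3" "b \<ge> 1" "distinct vs" and V: "set vs = insert None (Some ` ({..<b} \<times> ({..<n} - {2})))"
  shows "det (matrix_on vs star_gram) = - (real b * ((real n - 6) / 2) ^ (b - 1) * (- 2) ^ (b * (n - 2)))"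
proof -
  let ?s = "(real n - 6) / 2"
  have "matrix_on vs (star_reduced b ?s)
      = matrix_on vs (\<lambda>u v. \<Sum>a\<in>set vs. star_gram u a * star_elim ?s a v)"
    by (rule matrix_on_cong, unfold V)
      (rule star_gram_mult_star_elim[OF assms(1,2) refl, symmetric])
  then have "det (matrix_on vs (star_reduced b ?s)) = det (matrix_on vs star_gram)"
    by (simp add: det_matrix_on_mult[OF assms(3)] det_star_elim[OF assms(3)])
  then show ?thesis
    using det_star_reduced[OF assms, of ?s] by simp
qed

section \<open>The determinant of the distance matrix\<close>

theorem theorem3p1:
  fixes n b :: nat and vs :: "(nat \<times> nat) option list"
  assumes "n \<ge> 3" and "b \<ge> 2"
    and "distinct vs" and "set vs = pverts (triangles_block_graph n b)"
  shows "det (distance_matrix (triangles_block_graph n b) vs) =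
    (-1) powi (int b * (int n - 4) + 1) * 2 ^ (b * (n - 3) + 1) * real b * (real n - 6) ^ (b - 1)"
proof -
  have b: "b \<ge> 1" using assms(2) by simp
  have V: "set vs = insert None (Some ` ({..<b} \<times> ({..<n} - {2})))"
    using assms(4) pverts_triangles_block_graph[OF assms(1) b] by simp
  have "distance_matrix (triangles_block_graph n b) vs = matrix_on vs (\<lambda>u v. real (block_dist u v))"
  proof -
    have "block_dist u u = 0" for u by (cases u) auto
    then show ?thesis
      using graph_dist_triangles_block_graph[OF assms(1) b] assms(4)[symmetric]
      by (intro eq_matI) (auto simp: distance_matrix_def matrix_on_def)
  qed
  then have "det (distance_matrix (triangles_block_graph n b) vs)
      = - (real b * ((real n - 6) / 2) ^ (b - 1) * (- 2) ^ (b * (n - 2)))"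
    using det_block_dist_eq_det_star_gram[OF assms(1,3) V] det_star_gram[OF assms(1) b assms(3) V]
    by simp
  also have "\<dots> = (-1) powi (int b * (int n - 4) + 1) * 2 ^ (b * (n - 3) + 1) * real b * (real n - 6) ^ (b - 1)"
  proof -
    have sign: "(-1 :: real) powi (int b * (int n - 4) + 1) = - ((-1) ^ (b * (n - 2)))"
    proof -
      have "int b * (int n - 4) + 1 = int (b * (n - 2)) - 2 * int b + 1"
        using assms(1) by (simp add: algebra_simps of_nat_diff)
      then show ?thesis
        by (simp add: power_int_minus_left minus_one_power_iff)
    qed
    \<comment> \<open>The factor \<open>2 ^ (b - 1)\<close> cancels the denominators of the powers of \<open>s\<close>.\<close>
    have "b * (n - 2) = (b * (n - 3) + 1) + (b - 1)"
    proof -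
      have "n - 2 = Suc (n - 3)" using assms(1) by simp
      then show ?thesis using b by simp
    qed
    then have "(2 :: real) ^ (b * (n - 2)) = 2 ^ (b * (n - 3) + 1) * 2 ^ (b - 1)"
      by (metis power_add)
    then have two: "(- 2 :: real) ^ (b * (n - 2)) = (-1) ^ (b * (n - 2)) * (2 ^ (b * (n - 3) + 1) * 2 ^ (b - 1))"
      by (metis power_minus)
    show ?thesis
      unfolding sign two by (simp add: power_divide)
  qed
  finally show ?thesis .
qed

end
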